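(* Every $1$-saturated subcubic graph $G$ such that $g_3(G)\le 4$ is $(1,2,2,2)$-packing colorable.
   Context: All graphs are finite, simple and undirected. For a non-decreasing sequence $S=(s_1,\dots,s_k)$ of positive integers, an $S$-packing coloring of $G$ is a partition of $V(G)$ into sets $V_1,\dots,V_k$ such that any two distinct vertices $u,v\in V_i$ satisfy $dist_G(u,v)>s_i$; $G$ is $S$-packing colorable if it admits one. $G$ is subcubic if its maximum degree is at most $3$. A subcubic graph is $k$-saturated if every vertex of degree $3$ is adjacent to at most $k$ vertices of degree $3$. The local girth $g(v)$ of a vertex $v$ is the length of a shortest cycle containing $v$ ($\infty$ if none), and $g_3(G)=\max\{g(v): d_G(v)=3\}$. *)

theory Defs
  imports
    "Graph_Theory.Graph_Theory"
    "HOL-Library.Extended_Nat"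
    "HOL-Library.Disjoint_Sets"
begin

text \<open>
  A finite simple undirected graph is a \<^const>\<open>pair_graph\<close>: a finite loop-free digraph
  without parallel arcs in which each edge \<open>uv\<close> is represented by the two arcs
  \<open>(u, v)\<close> and \<open>(v, u)\<close>. Hence the degree of a vertex is its out-degree.
\<close>

abbreviation degree :: "'a pair_pre_digraph \<Rightarrow> 'a \<Rightarrow> nat" where
  "degree G v \<equiv> out_degree (with_proj G) v"

definition subcubic :: "'a pair_pre_digraph \<Rightarrow> bool" where
  "subcubic G \<longleftrightarrow> (\<forall>v\<in>pverts G. degree G v \<le> 3)"

definition saturated :: "nat \<Rightarrow> 'a pair_pre_digraph \<Rightarrow> bool" where
  "saturated k G \<longleftrightarrow>
     (\<forall>v\<in>pverts G. degree G v = 3 \<longrightarrow> card {w. (v, w) \<in> parcs G \<and> degree G w = 3} \<le> k)"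

text \<open>The number of edges on a shortest walk, and \<open>\<infinity>\<close> between different components.\<close>

definition gdist :: "'a pair_pre_digraph \<Rightarrow> 'a \<Rightarrow> 'a \<Rightarrow> ereal" where
  "gdist G u v = wf_digraph.\<mu> (with_proj G) (\<lambda>_. 1) u v"

text \<open>
  The library's \<^const>\<open>pre_digraph.cycle\<close> also accepts the closed walk \<open>(u, v), (v, u)\<close>
  along a single edge; the length bound excludes it. The infimum of the empty set is \<open>\<infinity>\<close>.
\<close>

definition local_girth :: "'a pair_pre_digraph \<Rightarrow> 'a \<Rightarrow> enat" where
  "local_girth G v =
     (INF p \<in> {p. pre_digraph.cycle (with_proj G) p \<and> 3 \<le> length p \<and> v \<in> fst ` set p}.
        enat (length p))"

text \<open>
  The supremum is a maximum because the graph is finite; it is \<open>0\<close> if there is no vertex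
  of degree 3.
\<close>

definition g3 :: "'a pair_pre_digraph \<Rightarrow> enat" where
  "g3 G = (SUP v \<in> {v \<in> pverts G. degree G v = 3}. local_girth G v)"

text \<open>
  \<open>S\<close> is meant to be a non-decreasing list of positive integers. The classes are indexed from
  \<open>0\<close>, and as usual for colorings a class may be empty.
\<close>

definition packing_coloring :: "'a pair_pre_digraph \<Rightarrow> nat list \<Rightarrow> (nat \<Rightarrow> 'a set) \<Rightarrow> bool" where
  "packing_coloring G S V \<longleftrightarrow>
     (\<Union>i<length S. V i) = pverts G \<and>
     disjoint_family_on V {..<length S} \<and>
     (\<forall>i<length S. \<forall>u\<in>V i. \<forall>v\<in>V i. u \<noteq> v \<longrightarrow> gdist G u v > ereal (real (S ! i)))"

definition packing_colorable :: "'a pair_pre_digraph \<Rightarrow> nat list \<Rightarrow> bool" where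
  "packing_colorable G S \<longleftrightarrow> (\<exists>V. packing_coloring G S V)"

end

theory Submission
  imports Defs
begin

text \<open>
  Let \<open>J\<close> be an independent set of vertices of degree at most 2 of maximum size, and extend it
  to a maximal independent set \<open>I\<close>, the colour class of radius 1. Call two vertices outside \<open>I\<close>
  in conflict if their distance is at most 2. The conflict graph is 2-degenerate, so three
  colours suffice for it greedily.

  For the degeneracy, let every vertex of \<open>S\<close> have at least 3 conflicts inside \<open>S\<close>. A neighbour of
  degree at most 2 leads to at most one conflict, because it lies in \<open>I\<close> or has a neighbour in \<open>I\<close>.
  By this count, a vertex of degree 3 in \<open>S\<close> shares a triangle with another vertex of degree 3, and
  its neighbour outside the triangle is not in \<open>I\<close>. Now let \<open>u\<close> in \<open>S\<close> have degree at most 2. It has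
  a neighbour \<open>z\<close> in \<open>J\<close>, and its other neighbour has degree 3 and leads to at most 2 conflicts, so
  \<open>z\<close> has a second neighbour \<open>q\<close> in \<open>S\<close>. By the shape of the triangles, \<open>q\<close> has degree at most 2 as
  well, and exchanging \<open>z\<close> for \<open>u\<close> and \<open>q\<close> enlarges \<open>J\<close>. Hence \<open>S\<close> consists of vertices of degree 3,
  which then have too few conflicts.
\<close>

lemma degenerate_imp_colorable:
  fixes C :: "'c set"
  assumes "symp R" and "finite W"
    and "\<And>S. S \<subseteq> W \<Longrightarrow> S \<noteq> {} \<Longrightarrow> \<exists>u\<in>S. card {w \<in> S. R u w} < card C"
  shows "\<exists>c. c ` W \<subseteq> C \<and> pairwise (\<lambda>u v. R u v \<longrightarrow> c u \<noteq> c v) W"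
  using assms(2,3)
proof (induction W rule: finite_psubset_induct)
  case (psubset W)
  show ?case
  proof (cases "W = {}")
    case True
    then show ?thesis by simp
  next
    case False
    then obtain u where u: "u \<in> W" and few: "card {w \<in> W. R u w} < card C"
      using psubset.prems by blast
    have "W - {u} \<subset> W" using u by blast
    then obtain c where range: "c ` (W - {u}) \<subseteq> C"
      and proper: "pairwise (\<lambda>v w. R v w \<longrightarrow> c v \<noteq> c w) (W - {u})"
      using psubset.IH[of "W - {u}"] psubset.prems by blast
    have finite_conflicts: "finite {w \<in> W. R u w}" using psubset.hyps by simp
    have "card (c ` {w \<in> W. R u w}) < card C"
      using card_image_le[OF finite_conflicts] few by (rule le_less_trans)
    then have "\<not> C \<subseteq> c ` {w \<in> W. R u w}"
      using card_mono finite_conflicts by (metis finite_imageI not_less)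
    then obtain k where "k \<in> C" and free: "\<And>w. w \<in> W \<Longrightarrow> R u w \<Longrightarrow> c w \<noteq> k" by auto
    have "(c(u := k)) ` W \<subseteq> C" using range \<open>k \<in> C\<close> by auto
    moreover have "pairwise (\<lambda>v w. R v w \<longrightarrow> (c(u := k)) v \<noteq> (c(u := k)) w) W"
      using proper free sympD[OF \<open>symp R\<close>] unfolding pairwise_def by auto
    ultimately show ?thesis by blast
  qed
qed

section \<open>Neighbourhoods, distances and short cycles\<close>

context pair_graph
begin

definition nbrs :: "'a \<Rightarrow> 'a set" where
  "nbrs v = {w. (v, w) \<in> parcs G}"

definition nbrs2 :: "'a \<Rightarrow> 'a set" where
  "nbrs2 u = (\<Union>n\<in>nbrs u. insert n (nbrs n)) - {u}"

definition independent :: "'a set \<Rightarrow> bool" where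
  "independent A \<longleftrightarrow> A \<subseteq> pverts G \<and> (\<forall>u\<in>A. nbrs u \<inter> A = {})"

lemma nbrs_subset: "nbrs v \<subseteq> pverts G"
  unfolding nbrs_def using in_arcsD2 by blast

lemma nbrs_outside: "v \<notin> pverts G \<Longrightarrow> nbrs v = {}"
  unfolding nbrs_def using in_arcsD1 by blast

lemma finite_nbrs: "finite (nbrs v)"
  using finite_subset[OF nbrs_subset] by simp

lemma nbrs_sym: "w \<in> nbrs v \<Longrightarrow> v \<in> nbrs w"
  unfolding nbrs_def using arcs_symmetric by blast

lemma nbrs_irrefl: "v \<notin> nbrs v"
  unfolding nbrs_def using no_loops' by blast

lemma degree_eq_card_nbrs: "degree G v = card (nbrs v)"
proof -
  have "out_arcs (with_proj G) v = Pair v ` nbrs v"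
    unfolding out_arcs_def nbrs_def by auto
  then show ?thesis unfolding out_degree_def by (simp add: card_image inj_on_def)
qed

lemma nbrs2_sym: "w \<in> nbrs2 u \<Longrightarrow> u \<in> nbrs2 w"
  unfolding nbrs2_def using nbrs_sym by blast

lemma independentD: "independent A \<Longrightarrow> u \<in> A \<Longrightarrow> w \<in> nbrs u \<Longrightarrow> w \<notin> A"
  unfolding independent_def by blast

lemma independent_subset: "independent A \<Longrightarrow> B \<subseteq> A \<Longrightarrow> independent B"
  unfolding independent_def by blast

lemma independent_insert:
  assumes "independent A" "u \<in> pverts G" "nbrs u \<inter> A = {}"
  shows "independent (insert u A)"
  using assms nbrs_sym nbrs_irrefl unfolding independent_def by blast

lemma finite_independent: "independent A \<Longrightarrow> finite A"
  unfolding independent_def using finite_subset[of A "pverts G"] by simp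

lemma awalk_cost_one: "awalk_cost (\<lambda>_. 1) p = real (length p)"
  by (induction p) simp_all

lemma gdist_gtI:
  assumes "\<And>p. awalk u p v \<Longrightarrow> k < length p"
  shows "ereal (real k) < gdist G u v"
proof -
  have "ereal (real (Suc k)) \<le> gdist G u v"
    unfolding gdist_def \<mu>_def
    by (rule INF_greatest) (use assms in \<open>simp add: awalk_cost_one Suc_le_eq del: of_nat_Suc\<close>)
  then show ?thesis by (rule less_le_trans[rotated]) simp
qed

lemma gdist_gt_1:
  assumes "u \<noteq> v" "v \<notin> nbrs u"
  shows "ereal (real 1) < gdist G u v"
proof (rule gdist_gtI)
  show "1 < length p" if "awalk u p v" for p
    using that assms by (cases p; cases "tl p") (auto simp: nbrs_def awalk_Cons_iff awalk_Nil_iff)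
qed

lemma gdist_gt_2:
  assumes "u \<noteq> v" "v \<notin> nbrs2 u"
  shows "ereal (real 2) < gdist G u v"
proof (rule gdist_gtI)
  show "2 < length p" if "awalk u p v" for p
    using that assms by (cases p; cases "tl p"; cases "tl (tl p)")
      (auto simp: nbrs2_def nbrs_def awalk_Cons_iff awalk_Nil_iff)
qed

lemma packing_colorable_if_proper:
  assumes indep: "independent I"
    and range: "c ` (pverts G - I) \<subseteq> {1..k}"
    and proper: "pairwise (\<lambda>u w. w \<in> nbrs2 u \<longrightarrow> c u \<noteq> c w) (pverts G - I)"
  shows "packing_colorable G (1 # replicate k 2)"
proof -
  define V where "V i = (if i = 0 then I else {v \<in> pverts G - I. c v = i})" for i
  have "v \<in> (\<Union>i<Suc k. V i)" if v: "v \<in> pverts G" for v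
  proof (cases "v \<in> I")
    case True
    then show ?thesis unfolding V_def by auto
  next
    case False
    then have "c v \<in> {1..k}" using range v by blast
    then show ?thesis using False v unfolding V_def by (intro UN_I[of "c v"]) auto
  qed
  moreover have "V i \<subseteq> pverts G" for i using indep unfolding V_def independent_def by auto
  ultimately have "(\<Union>i<Suc k. V i) = pverts G" by blast
  moreover have "disjoint_family_on V {..<Suc k}"
    unfolding disjoint_family_on_def V_def by auto
  moreover have "ereal (real ((1 # replicate k 2) ! i)) < gdist G u v"
    if "i < Suc k" "u \<in> V i" "v \<in> V i" "u \<noteq> v" for i u v
  proof (cases i)
    case 0
    then show ?thesis using that independentD[OF indep] gdist_gt_1 by (auto simp: V_def)
  next
    case (Suc j)
    then have "u \<in> pverts G - I" "v \<in> pverts G - I" "c u = c v" using that by (auto simp: V_def)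
    then have "v \<notin> nbrs2 u" using pairwiseD[OF proper] \<open>u \<noteq> v\<close> by blast
    then show ?thesis using that Suc gdist_gt_2 by simp
  qed
  ultimately have "packing_coloring G (1 # replicate k 2) V"
    unfolding packing_coloring_def by simp
  then show ?thesis unfolding packing_colorable_def by blast
qed

lemma packing_colorable_if_degenerate:
  assumes indep: "independent I"
    and few: "\<And>S. S \<subseteq> pverts G - I \<Longrightarrow> S \<noteq> {} \<Longrightarrow> \<exists>u\<in>S. card (nbrs2 u \<inter> S) < k"
  shows "packing_colorable G (1 # replicate k 2)"
proof -
  have "\<exists>c. c ` (pverts G - I) \<subseteq> {1..k} \<and>
      pairwise (\<lambda>u w. w \<in> nbrs2 u \<longrightarrow> c u \<noteq> c w) (pverts G - I)"
  proof (rule degenerate_imp_colorable)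
    show "symp (\<lambda>u w. w \<in> nbrs2 u)" by (rule sympI) (rule nbrs2_sym)
    show "finite (pverts G - I)" by simp
    show "\<exists>u\<in>S. card {w \<in> S. w \<in> nbrs2 u} < card {1..k}"
      if "S \<subseteq> pverts G - I" "S \<noteq> {}" for S
      using few[OF that] by (simp add: Int_def conj_commute)
  qed
  then show ?thesis using packing_colorable_if_proper[OF indep] by blast
qed

definition on_short_cycle :: "'a \<Rightarrow> 'a \<Rightarrow> 'a \<Rightarrow> bool" where
  "on_short_cycle v a b \<longleftrightarrow> a \<in> nbrs v \<and> b \<in> nbrs v \<and> a \<noteq> b \<and>
     (b \<in> nbrs a \<or> (\<exists>w. w \<noteq> v \<and> w \<in> nbrs a \<and> w \<in> nbrs b))"

lemma on_short_cycle_sym: "on_short_cycle v a b \<Longrightarrow> on_short_cycle v b a"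
  unfolding on_short_cycle_def using nbrs_sym by blast

lemma on_short_cycle_if_closed_walk_3:
  assumes "y \<in> nbrs x" "z \<in> nbrs y" "x \<in> nbrs z"
  shows "on_short_cycle x y z"
  using assms nbrs_sym[of x z] nbrs_irrefl[of y] unfolding on_short_cycle_def by auto

lemma on_short_cycle_if_closed_walk_4:
  assumes "y \<in> nbrs x" "z \<in> nbrs y" "w \<in> nbrs z" "x \<in> nbrs w" "x \<noteq> z" "y \<noteq> w"
  shows "on_short_cycle x y w"
  using assms nbrs_sym[of x w] nbrs_sym[of w z] unfolding on_short_cycle_def by auto

lemma on_short_cycle_if_cycle_3:
  assumes "cycle p" "length p = 3" "v \<in> fst ` set p"
  shows "\<exists>a b. on_short_cycle v a b"
proof -
  obtain e1 e2 e3 where "p = [e1, e2, e3]"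
    using assms(2) by (auto simp: numeral_3_eq_3 length_Suc_conv)
  then obtain x y z where p: "p = [(x, y), (y, z), (z, x)]"
    and "y \<in> nbrs x" "z \<in> nbrs y" "x \<in> nbrs z"
    using assms(1) unfolding cycle_def nbrs_def
    by (cases e1; cases e2; cases e3) (auto simp: awalk_Cons_iff awalk_Nil_iff)
  then have "on_short_cycle x y z" "on_short_cycle y z x" "on_short_cycle z x y"
    by (simp_all add: on_short_cycle_if_closed_walk_3)
  then show ?thesis using assms(3) p by auto
qed

lemma on_short_cycle_if_cycle_4:
  assumes "cycle p" "length p = 4" "v \<in> fst ` set p"
  shows "\<exists>a b. on_short_cycle v a b"
proof -
  obtain e1 e2 e3 e4 where "p = [e1, e2, e3, e4]"
    using assms(2) by (auto simp: eval_nat_numeral length_Suc_conv)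
  then obtain x y z w where p: "p = [(x, y), (y, z), (z, w), (w, x)]"
    and "y \<in> nbrs x" "z \<in> nbrs y" "w \<in> nbrs z" "x \<in> nbrs w" "x \<noteq> z" "y \<noteq> w"
    using assms(1) unfolding cycle_def nbrs_def
    by (cases e1; cases e2; cases e3; cases e4) (auto simp: awalk_Cons_iff awalk_Nil_iff)
  then have "on_short_cycle x y w" "on_short_cycle y z x" "on_short_cycle z w y"
    "on_short_cycle w x z"
    using on_short_cycle_if_closed_walk_4 by simp_all
  then show ?thesis using assms(3) p by auto
qed

lemma local_girth_leE:
  assumes "local_girth G v \<le> enat k"
  obtains p where "cycle p" "3 \<le> length p" "length p \<le> k" "v \<in> fst ` set p"
proof -
  have "local_girth G v < enat (Suc k)" using assms by (rule le_less_trans) simp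
  then obtain p where "cycle p" "3 \<le> length p" "v \<in> fst ` set p" "length p < Suc k"
    unfolding local_girth_def INF_less_iff by auto
  then show ?thesis using that by simp
qed

lemma on_short_cycle_if_local_girth_le_4:
  assumes "local_girth G v \<le> 4"
  shows "\<exists>a b. on_short_cycle v a b"
proof -
  have "local_girth G v \<le> enat 4" using assms by (simp add: numeral_eq_enat)
  then obtain p where p: "cycle p" "3 \<le> length p" "length p \<le> 4" "v \<in> fst ` set p"
    by (rule local_girth_leE)
  then consider "length p = 3" | "length p = 4" by linarith
  then show ?thesis
    using on_short_cycle_if_cycle_3[OF p(1) _ p(4)] on_short_cycle_if_cycle_4[OF p(1) _ p(4)]
    by cases
qed

end

section \<open>Maximal independent sets with priority\<close>

locale prioritized_independent_set = pair_graph +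
  fixes D I :: "'a set"
  assumes independent_I: "independent I"
    and maximal: "independent A \<Longrightarrow> I \<subseteq> A \<Longrightarrow> A = I"
    and priority: "independent A \<Longrightarrow> A \<subseteq> D \<Longrightarrow> card A \<le> card (I \<inter> D)"
begin

lemma dominating:
  assumes "u \<in> pverts G" "u \<notin> I"
  obtains z where "z \<in> nbrs u" "z \<in> I"
  using maximal[OF independent_insert[OF independent_I assms(1)]] assms(2) by blast

lemma priority_dominating:
  assumes "u \<in> pverts G" "u \<notin> I" "u \<in> D"
  obtains z where "z \<in> nbrs u" "z \<in> I" "z \<in> D"
proof (rule ccontr)
  assume no_nbr: "\<not> thesis"
  have "independent (I \<inter> D)" by (rule independent_subset[OF independent_I]) simp
  moreover have "nbrs u \<inter> (I \<inter> D) = {}" using no_nbr that by blast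
  ultimately have "independent (insert u (I \<inter> D))" using assms(1) independent_insert by blast
  then have "card (insert u (I \<inter> D)) \<le> card (I \<inter> D)" using priority assms(3) by blast
  then show False using assms(2) finite_independent[OF independent_I] by simp
qed

lemma no_exchange:
  assumes z: "z \<in> I" "z \<in> D"
    and p: "p \<in> pverts G" "p \<notin> I" "p \<in> D"
    and q: "q \<in> pverts G" "q \<notin> I" "q \<in> D"
    and pq: "p \<noteq> q" "q \<notin> nbrs p"
  obtains t where "t \<noteq> z" "t \<in> I" "t \<in> D" "t \<in> nbrs p \<union> nbrs q"
proof (rule ccontr)
  assume no_nbr: "\<not> thesis"
  define J where "J = I \<inter> D - {z}"
  have J: "finite J" "p \<notin> J" "q \<notin> J" "card (I \<inter> D) = Suc (card J)"
    unfolding J_def using p q z finite_independent[OF independent_I]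
    by (simp_all del: card_Diff_insert add: card.remove[of "I \<inter> D" z])
  have free: "nbrs p \<inter> J = {}" "nbrs q \<inter> J = {}" unfolding J_def using no_nbr that by blast+
  have "independent J" unfolding J_def by (rule independent_subset[OF independent_I]) blast
  then have "independent (insert q J)" using independent_insert q(1) free(2) by blast
  then have "independent (insert p (insert q J))"
    using independent_insert p(1) free(1) pq(2) by blast
  moreover have "insert p (insert q J) \<subseteq> D" unfolding J_def using p q by blast
  ultimately have "card (insert p (insert q J)) \<le> card (I \<inter> D)" by (rule priority)
  then show False using J pq(1) by simp
qed

end

lemma (in pair_graph) ex_prioritized_independent_set: "\<exists>I. prioritized_independent_set G D I"
proof -
  have bound: "card A < Suc (card (pverts G))" if "independent A" for A
    using that card_mono[of "pverts G" A] by (simp add: independent_def less_Suc_eq_le)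
  have "\<exists>J. (independent J \<and> J \<subseteq> D) \<and>
      (\<forall>A. independent A \<and> A \<subseteq> D \<longrightarrow> card A \<le> card J)"
  proof (rule ex_has_greatest_nat)
    show "independent {} \<and> {} \<subseteq> D" unfolding independent_def by simp
    show "\<forall>A. independent A \<and> A \<subseteq> D \<longrightarrow> card A < Suc (card (pverts G))"
      using bound by blast
  qed
  then obtain J where J: "independent J" "J \<subseteq> D"
    and J_max: "\<And>A. independent A \<Longrightarrow> A \<subseteq> D \<Longrightarrow> card A \<le> card J" by blast
  have "finite {A. independent A}"
    by (rule finite_subset[of _ "Pow (pverts G)"]) (auto simp: independent_def)
  then obtain I where I: "independent I" "J \<subseteq> I" "\<And>A. independent A \<Longrightarrow> I \<subseteq> A \<Longrightarrow> A = I"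
    using finite_has_maximal2[of "{A. independent A}" J] J(1) by auto
  have "card J \<le> card (I \<inter> D)"
    using J(2) I(2) finite_independent[OF I(1)] by (intro card_mono) auto
  then have "card A \<le> card (I \<inter> D)" if "independent A" "A \<subseteq> D" for A
    using J_max[OF that] by (rule order_trans[rotated])
  then have "prioritized_independent_set G D I" using I(1,3) by unfold_locales
  then show ?thesis by blast
qed

section \<open>Short cycles through vertices of degree 3\<close>

locale short_cycle_graph = pair_graph +
  assumes subcubic: "subcubic G"
    and saturated: "saturated 1 G"
    and g3_le_4: "g3 G \<le> 4"
begin

abbreviation cubic :: "'a \<Rightarrow> bool" where
  "cubic v \<equiv> degree G v = 3"

lemma card_nbrs_le_3: "card (nbrs v) \<le> 3"
proof (cases "v \<in> pverts G")
  case True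
  then show ?thesis using subcubic unfolding subcubic_def degree_eq_card_nbrs by blast
qed (simp add: nbrs_outside)

lemma cubic_in_pverts: "cubic v \<Longrightarrow> v \<in> pverts G"
  unfolding degree_eq_card_nbrs using nbrs_outside[of v] by fastforce

lemma cubic_nbr_unique:
  assumes v: "cubic v" and "a \<in> nbrs v" "cubic a" "b \<in> nbrs v" "cubic b"
  shows "a = b"
proof -
  let ?C = "{w. (v, w) \<in> parcs G \<and> cubic w}"
  have "card ?C \<le> 1" using saturated cubic_in_pverts[OF v] v unfolding saturated_def by blast
  moreover have "finite ?C" by (rule finite_subset[OF _ finite_nbrs[of v]]) (auto simp: nbrs_def)
  ultimately show ?thesis using assms(2-) by (auto simp: nbrs_def card_le_Suc0_iff_eq)
qed

lemma cubic_on_short_cycle: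
  assumes "cubic v"
  shows "\<exists>a b. on_short_cycle v a b"
proof (rule on_short_cycle_if_local_girth_le_4)
  have "local_girth G v \<le> g3 G"
    unfolding g3_def using assms cubic_in_pverts by (intro SUP_upper) simp
  then show "local_girth G v \<le> 4" using g3_le_4 by simp
qed

lemma nbrs_eq_pair:
  assumes "\<not> cubic v" "a \<in> nbrs v" "b \<in> nbrs v" "a \<noteq> b"
  shows "nbrs v = {a, b}"
proof -
  have "card (nbrs v) \<le> card {a, b}"
    using assms card_nbrs_le_3[of v] by (simp add: degree_eq_card_nbrs)
  then show ?thesis using card_seteq[OF finite_nbrs, of "{a, b}" v] assms by auto
qed

lemma nbrs_eq_triple:
  assumes "cubic v" "a \<in> nbrs v" "b \<in> nbrs v" "a \<noteq> b"
  obtains x where "nbrs v = {a, b, x}"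
proof -
  have "card (nbrs v - {a, b}) = 1"
    using assms finite_nbrs by (simp add: card_Diff_subset degree_eq_card_nbrs)
  then obtain x where "nbrs v - {a, b} = {x}" by (auto simp: card_1_singleton_iff)
  then show ?thesis using that[of x] assms by blast
qed

lemma nbrs_triple_distinct: "cubic v \<Longrightarrow> nbrs v = {a, b, x} \<Longrightarrow> a \<noteq> b \<and> x \<noteq> a \<and> x \<noteq> b"
  by (auto simp: degree_eq_card_nbrs card_insert_if split: if_splits)

lemma not_cubic_if_pair: "nbrs v = {a, b} \<Longrightarrow> \<not> cubic v"
  by (simp add: degree_eq_card_nbrs card_insert_if)

definition twin_triangle :: "'a \<Rightarrow> 'a \<Rightarrow> 'a \<Rightarrow> 'a \<Rightarrow> 'a \<Rightarrow> bool" where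
  "twin_triangle v a b x y \<longleftrightarrow> cubic v \<and> cubic a \<and>
     nbrs v = {a, b, x} \<and> nbrs a = {v, b, y} \<and> nbrs b = {v, a}"

definition twin_square :: "'a \<Rightarrow> 'a \<Rightarrow> 'a \<Rightarrow> 'a \<Rightarrow> 'a \<Rightarrow> 'a \<Rightarrow> bool" where
  "twin_square v a b w x y \<longleftrightarrow> cubic v \<and> cubic a \<and>
     nbrs v = {a, b, x} \<and> nbrs a = {v, w, y} \<and> nbrs b = {v, w} \<and> nbrs w = {a, b}"

definition solitary :: "'a \<Rightarrow> bool" where
  "solitary v \<longleftrightarrow> cubic v \<and>
     (\<nexists>a b x y. twin_triangle v a b x y) \<and> (\<nexists>a b w x y. twin_square v a b w x y)"

lemma twin_triangle_sym: "twin_triangle v a b x y \<Longrightarrow> twin_triangle a v b y x"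
  unfolding twin_triangle_def by auto

lemma twin_square_sym: "twin_square v a b w x y \<Longrightarrow> twin_square a v w b y x"
  unfolding twin_square_def by auto

lemma cubic_twin_nbrs_not_cubic:
  assumes "cubic v" "cubic a" "nbrs v = {a, b, x}"
  shows "\<not> cubic b \<and> \<not> cubic x"
proof -
  have "a \<in> nbrs v" using assms(3) by simp
  then have "c = a" if "c \<in> nbrs v" "cubic c" for c
    using cubic_nbr_unique[OF assms(1) that] assms(2) by simp
  then show ?thesis using nbrs_triple_distinct[OF assms(1,3)] assms(3) by auto
qed

lemma twin_triangle_not_cubic: "twin_triangle v a b x y \<Longrightarrow> \<not> cubic b \<and> \<not> cubic x \<and> \<not> cubic y"
  unfolding twin_triangle_def using cubic_twin_nbrs_not_cubic by blast

lemma twin_square_not_cubic: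
  "twin_square v a b w x y \<Longrightarrow> \<not> cubic b \<and> \<not> cubic w \<and> \<not> cubic x \<and> \<not> cubic y"
  unfolding twin_square_def using cubic_twin_nbrs_not_cubic by blast

lemma ex_twin_triangle:
  assumes v: "cubic v" and a: "cubic a" and nbrs: "a \<in> nbrs v" "b \<in> nbrs v" "b \<in> nbrs a"
  shows "\<exists>x y. twin_triangle v a b x y"
proof -
  have ne: "a \<noteq> b" "v \<noteq> b" "v \<noteq> a" using nbrs nbrs_irrefl by blast+
  have sym: "v \<in> nbrs a" "v \<in> nbrs b" "a \<in> nbrs b" using nbrs nbrs_sym by blast+
  obtain x where x: "nbrs v = {a, b, x}" using nbrs_eq_triple v nbrs(1,2) ne(1) by metis
  obtain y where y: "nbrs a = {v, b, y}" using nbrs_eq_triple a sym(1) nbrs(3) ne(2) by metis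
  have "nbrs b = {v, a}"
    using nbrs_eq_pair cubic_twin_nbrs_not_cubic[OF v a x] sym ne by blast
  then show ?thesis using v a x y unfolding twin_triangle_def by blast
qed

lemma ex_twin_square:
  assumes v: "cubic v" and a: "cubic a"
    and nbrs: "a \<in> nbrs v" "b \<in> nbrs v" "w \<in> nbrs a" "w \<in> nbrs b" and ne: "a \<noteq> b" "w \<noteq> v"
  shows "\<exists>x y. twin_square v a b w x y"
proof -
  have sym: "v \<in> nbrs a" "v \<in> nbrs b" "a \<in> nbrs w" "b \<in> nbrs w" using nbrs nbrs_sym by blast+
  obtain x where x: "nbrs v = {a, b, x}" using nbrs_eq_triple v nbrs(1,2) ne(1) by metis
  obtain y where y: "nbrs a = {v, w, y}" using nbrs_eq_triple a sym(1) nbrs(3) ne(2) by metis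
  have "nbrs b = {v, w}"
    using nbrs_eq_pair cubic_twin_nbrs_not_cubic[OF v a x] sym(2) nbrs(4) ne(2) by blast
  moreover have "nbrs w = {a, b}"
    using nbrs_eq_pair cubic_twin_nbrs_not_cubic[OF a v y] sym(3,4) ne(1) by blast
  ultimately show ?thesis using v a x y unfolding twin_square_def by blast
qed

lemma solitary_cubic_nbr:
  assumes v: "solitary v" and x: "x \<in> nbrs v" "cubic x"
  shows "solitary x"
proof -
  have cubic_v: "v \<in> nbrs x" "cubic v" using v x nbrs_sym unfolding solitary_def by blast+
  have twin: "a = v" if "a \<in> nbrs x" "cubic a" for a
    by (rule cubic_nbr_unique[OF x(2) that cubic_v])
  have "\<not> twin_triangle x a b x' y" for a b x' y
  proof
    assume t: "twin_triangle x a b x' y"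
    then have "a = v" using twin[of a] unfolding twin_triangle_def by simp
    then have "twin_triangle v x b y x'" using twin_triangle_sym[OF t] by simp
    then show False using v unfolding solitary_def by blast
  qed
  moreover have "\<not> twin_square x a b w x' y" for a b w x' y
  proof
    assume s: "twin_square x a b w x' y"
    then have "a = v" using twin[of a] unfolding twin_square_def by simp
    then have "twin_square v x w b y x'" using twin_square_sym[OF s] by simp
    then show False using v unfolding solitary_def by blast
  qed
  ultimately show ?thesis using x(2) unfolding solitary_def by blast
qed

lemma solitary_short_cycle_not_cubic:
  assumes v: "solitary v" and cyc: "on_short_cycle v a b"
  shows "\<not> cubic a"
proof
  assume a: "cubic a"
  have ab: "a \<in> nbrs v" "b \<in> nbrs v" "a \<noteq> b"
    and "b \<in> nbrs a \<or> (\<exists>w. w \<noteq> v \<and> w \<in> nbrs a \<and> w \<in> nbrs b)"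
    using cyc unfolding on_short_cycle_def by blast+
  then consider (triangle) "b \<in> nbrs a" | (square) w where "w \<noteq> v" "w \<in> nbrs a" "w \<in> nbrs b"
    by blast
  then show False
  proof cases
    case triangle
    then show False using ex_twin_triangle[of v a b] a ab v unfolding solitary_def by blast
  next
    case (square w)
    then show False using ex_twin_square[of v a b w] a ab v unfolding solitary_def by blast
  qed
qed

lemma solitary_cases:
  assumes v: "solitary v"
  obtains
    (Triangle) a b x where "nbrs v = {a, b, x}" "nbrs a = {v, b}" "nbrs b = {v, a}"
  | (Square) a b x w where "nbrs v = {a, b, x}" "nbrs a = {v, w}" "nbrs b = {v, w}" "w \<noteq> v"
proof -
  have "cubic v" using v unfolding solitary_def by blast
  then obtain a b where cyc: "on_short_cycle v a b" using cubic_on_short_cycle by blast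
  then have ab: "a \<in> nbrs v" "b \<in> nbrs v" "a \<noteq> b" unfolding on_short_cycle_def by blast+
  obtain x where x: "nbrs v = {a, b, x}" using nbrs_eq_triple \<open>cubic v\<close> ab by metis
  have low: "\<not> cubic a" "\<not> cubic b"
    using solitary_short_cycle_not_cubic[OF v] cyc on_short_cycle_sym by blast+
  have sym: "v \<in> nbrs a" "v \<in> nbrs b" using ab nbrs_sym by blast+
  consider (triangle) "b \<in> nbrs a" | (square) w where "w \<noteq> v" "w \<in> nbrs a" "w \<in> nbrs b"
    using cyc unfolding on_short_cycle_def by blast
  then show thesis
  proof cases
    case triangle
    have ne: "v \<noteq> a" "v \<noteq> b" using ab nbrs_irrefl by blast+
    have "nbrs a = {v, b}" by (rule nbrs_eq_pair[OF low(1) sym(1) triangle ne(2)])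
    moreover have "nbrs b = {v, a}"
      by (rule nbrs_eq_pair[OF low(2) sym(2) nbrs_sym[OF triangle] ne(1)])
    ultimately show thesis by (rule Triangle[OF x])
  next
    case (square w)
    then have ne: "v \<noteq> w" by simp
    have "nbrs a = {v, w}" by (rule nbrs_eq_pair[OF low(1) sym(1) square(2) ne])
    moreover have "nbrs b = {v, w}" by (rule nbrs_eq_pair[OF low(2) sym(2) square(3) ne])
    ultimately show thesis using square(1) by (rule Square[OF x])
  qed
qed

end

section \<open>Degeneracy of the conflict graph\<close>

locale low_first_independent_set =
  short_cycle_graph G + prioritized_independent_set G "{v. degree G v \<noteq> 3}" I
  for G :: "'a pair_pre_digraph" and I
begin

lemma low_dominating:
  assumes "u \<in> pverts G" "u \<notin> I" "\<not> cubic u"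
  obtains z where "z \<in> nbrs u" "z \<in> I" "\<not> cubic z"
  using priority_dominating assms by blast

lemma twin_triangle_apex_in_I:
  assumes "twin_triangle v a b x y"
  shows "b \<in> I"
proof (rule ccontr)
  have "b \<in> pverts G" "\<not> cubic b"
    using assms nbrs_subset[of v] twin_triangle_not_cubic unfolding twin_triangle_def by blast+
  moreover assume "b \<notin> I"
  ultimately obtain z where "z \<in> nbrs b" "\<not> cubic z" using low_dominating by metis
  then show False using assms unfolding twin_triangle_def by auto
qed

lemma twin_square_base_in_I:
  assumes "twin_square v a b w x y"
  shows "b \<in> I \<or> w \<in> I"
proof (rule disjCI)
  have "b \<in> pverts G" "\<not> cubic b"
    using assms nbrs_subset[of v] twin_square_not_cubic unfolding twin_square_def by blast+
  moreover assume "w \<notin> I"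
  moreover have "z = w" if "z \<in> nbrs b" "\<not> cubic z" for z
    using assms that unfolding twin_square_def by auto
  ultimately show "b \<in> I" using low_dominating by metis
qed

lemma solitary_triangle_in_I:
  assumes v: "cubic v" and nbrs_eq: "nbrs v = {a, b, x}" "nbrs a = {v, b}" "nbrs b = {v, a}"
  shows "a \<in> I \<or> b \<in> I"
proof (rule disjCI)
  have "a \<in> pverts G" "\<not> cubic a"
    using nbrs_eq(1) nbrs_subset[of v] not_cubic_if_pair[OF nbrs_eq(2)] by blast+
  moreover assume "b \<notin> I"
  moreover have "z = b" if "z \<in> nbrs a" "\<not> cubic z" for z using nbrs_eq(2) v that by auto
  ultimately show "a \<in> I" using low_dominating by metis
qed

lemma solitary_square_in_I:
  assumes v: "cubic v" and nbrs_eq: "nbrs v = {a, b, x}" "nbrs a = {v, w}" "nbrs b = {v, w}"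
  shows "a \<in> I \<and> b \<in> I"
proof (rule ccontr)
  have verts: "a \<in> pverts G" "b \<in> pverts G" using nbrs_eq(1) nbrs_subset[of v] by blast+
  have low: "\<not> cubic a" "\<not> cubic b" using nbrs_eq not_cubic_if_pair by blast+
  have w_only: "z = w" if "z \<in> nbrs a \<union> nbrs b" "\<not> cubic z" for z using nbrs_eq v that by auto
  assume "\<not> (a \<in> I \<and> b \<in> I)"
  then have w: "w \<in> I" "\<not> cubic w" using low_dominating w_only verts low by (metis UnCI)+
  have "a \<in> nbrs w" "b \<in> nbrs w" using nbrs_eq nbrs_sym by blast+
  then have not_I: "a \<notin> I" "b \<notin> I" using independentD[OF independent_I w(1)] by blast+
  have "b \<noteq> v" "b \<noteq> w" using nbrs_eq nbrs_irrefl by blast+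
  then have "a \<noteq> b" "b \<notin> nbrs a" using nbrs_triple_distinct[OF v nbrs_eq(1)] nbrs_eq(2) by auto
  then obtain t where "t \<noteq> w" "\<not> cubic t" "t \<in> nbrs a \<union> nbrs b"
    using no_exchange[of w a b] w verts low not_I by auto
  then show False using w_only by blast
qed

end

locale dense_conflicts = low_first_independent_set +
  fixes S :: "'a set"
  assumes S_subset: "S \<subseteq> pverts G - I"
    and S_dense: "u \<in> S \<Longrightarrow> 3 \<le> card (nbrs2 u \<inter> S)"
begin

definition conflicts_via :: "'a \<Rightarrow> 'a \<Rightarrow> 'a set" where
  "conflicts_via u n = (insert n (nbrs n) - {u}) \<inter> S"

lemma I_not_in_S: "u \<in> I \<Longrightarrow> u \<notin> S"
  using S_subset by blast

lemma not_in_S_if_two_conflicts: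
  assumes "(\<Union>n\<in>nbrs u. conflicts_via u n) \<subseteq> {p, q}"
  shows "u \<notin> S"
proof
  assume "u \<in> S"
  have "nbrs2 u \<inter> S = (\<Union>n\<in>nbrs u. conflicts_via u n)"
    unfolding nbrs2_def conflicts_via_def by blast
  then have "3 \<le> card (\<Union>n\<in>nbrs u. conflicts_via u n)" using S_dense[OF \<open>u \<in> S\<close>] by simp
  also have "\<dots> \<le> card {p, q}" using assms by (intro card_mono) auto
  also have "\<dots> \<le> 2" by (simp add: card_insert_if)
  finally show False by simp
qed

lemma nbr_dominated:
  assumes "n \<in> nbrs u" "n \<notin> I"
  shows "\<exists>z. z \<in> nbrs n \<and> z \<in> I"
  using dominating[of n] assms nbrs_subset by blast

lemma conflicts_via_low:
  assumes "u \<notin> I" "n \<in> nbrs u" "\<not> cubic n"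
  obtains t where "conflicts_via u n \<subseteq> {t}"
proof -
  have u: "u \<in> nbrs n" using assms(2) by (rule nbrs_sym)
  show thesis
  proof (cases "n \<in> I")
    case False
    then obtain z where z: "z \<in> nbrs n" "z \<in> I" using nbr_dominated assms(2) by blast
    then have "nbrs n = {u, z}" using nbrs_eq_pair assms(1,3) u by blast
    then show thesis using that[of n] I_not_in_S[OF z(2)] unfolding conflicts_via_def by blast
  next
    case True
    have "\<exists>t. nbrs n \<subseteq> {u, t}" using nbrs_eq_pair[OF assms(3) u] by blast
    then show thesis using that I_not_in_S[OF True] unfolding conflicts_via_def by blast
  qed
qed

lemma conflicts_via_cubic:
  assumes "u \<notin> I" "n \<in> nbrs u" "cubic n"
  obtains p q where "conflicts_via u n \<subseteq> {p, q}"
proof -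
  have u: "u \<in> nbrs n" using assms(2) by (rule nbrs_sym)
  show thesis
  proof (cases "n \<in> I")
    case False
    then obtain z where z: "z \<in> nbrs n" "z \<in> I" using nbr_dominated assms(2) by blast
    then obtain p where "nbrs n = {u, z, p}" using nbrs_eq_triple assms(1,3) u by metis
    then show thesis using that[of n p] I_not_in_S[OF z(2)] unfolding conflicts_via_def by blast
  next
    case True
    have "nbrs n \<noteq> {u, u}" using not_cubic_if_pair assms(3) by blast
    then obtain p where "p \<in> nbrs n" "p \<noteq> u" using u by blast
    then obtain q where "nbrs n = {u, p, q}" using nbrs_eq_triple assms(3) u by metis
    then show thesis using that[of p q] I_not_in_S[OF True] unfolding conflicts_via_def by blast
  qed
qed

lemma twin_square_twin_or_pendant_not_in_S:
  assumes square: "twin_square v a b w x y" and b: "b \<in> I"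
  shows "a \<notin> S \<or> y \<notin> S"
proof (cases "a \<in> I")
  case True
  then show ?thesis using I_not_in_S by blast
next
  case False
  have nbrs_eq: "a \<in> nbrs v" "nbrs a = {v, w, y}" "nbrs b = {v, w}"
    using square unfolding twin_square_def by simp_all
  have "v \<notin> I" "w \<notin> I" using independentD[OF independent_I b] nbrs_eq(3) by auto
  then have "y \<in> I" using nbr_dominated[OF nbrs_eq(1) False] nbrs_eq(2) by auto
  then show ?thesis using I_not_in_S by blast
qed

lemma twin_square_not_in_S_if_base_in_I:
  assumes square: "twin_square v a b w x y" and b: "b \<in> I"
  shows "v \<notin> S \<and> a \<notin> S"
proof -
  have nbrs_eq: "nbrs v = {a, b, x}" "nbrs a = {v, w, y}" "nbrs b = {v, w}" "nbrs w = {a, b}"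
    using square unfolding twin_square_def by auto
  have low: "\<not> cubic x" "\<not> cubic y" using twin_square_not_cubic[OF square] by blast+
  have v_not_I: "v \<notin> I" using independentD[OF independent_I b] nbrs_eq(3) by auto
  have b_not_S: "b \<notin> S" using I_not_in_S[OF b] .
  obtain r where a_or_y: "{a, y} \<inter> S \<subseteq> {r}"
    using twin_square_twin_or_pendant_not_in_S[OF square b] by blast
  obtain t where via_x: "conflicts_via v x \<subseteq> {t}"
    using conflicts_via_low[OF v_not_I] low(1) nbrs_eq(1) by blast
  have w_not_S: "w \<notin> S"
    by (rule not_in_S_if_two_conflicts[of w v r])
      (use nbrs_eq b_not_S a_or_y in \<open>auto simp: conflicts_via_def\<close>)
  have v_not_S: "v \<notin> S"
    by (rule not_in_S_if_two_conflicts[of v r t])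
      (use nbrs_eq b_not_S w_not_S a_or_y via_x in \<open>auto simp: conflicts_via_def\<close>)
  have "a \<notin> S"
  proof (cases "a \<in> I")
    case False
    then obtain s where via_y: "conflicts_via a y \<subseteq> {s}"
      using conflicts_via_low low(2) nbrs_eq(2) by blast
    show ?thesis
      by (rule not_in_S_if_two_conflicts[of a x s])
        (use nbrs_eq b_not_S w_not_S v_not_S via_y in \<open>auto simp: conflicts_via_def\<close>)
  qed (rule I_not_in_S)
  then show ?thesis using v_not_S by blast
qed

lemma twin_square_not_in_S:
  assumes "twin_square v a b w x y"
  shows "v \<notin> S"
  using twin_square_base_in_I[OF assms] twin_square_not_in_S_if_base_in_I assms twin_square_sym
  by blast

lemma twin_triangle_not_in_S_if_pendant_in_I:
  assumes triangle: "twin_triangle v a b x y" and x: "x \<in> I"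
  shows "v \<notin> S"
proof -
  have nbrs_eq: "nbrs v = {a, b, x}" "nbrs a = {v, b, y}" "nbrs b = {v, a}"
    using triangle unfolding twin_triangle_def by auto
  have low: "\<not> cubic x" "\<not> cubic y" using twin_triangle_not_cubic[OF triangle] by blast+
  have b: "b \<in> I" by (rule twin_triangle_apex_in_I[OF triangle])
  have not_I: "v \<notin> I" "a \<notin> I" using independentD[OF independent_I b] nbrs_eq(3) by auto
  have not_S: "b \<notin> S" "x \<notin> S" using b x I_not_in_S by blast+
  obtain s where via_y: "conflicts_via a y \<subseteq> {s}"
    using conflicts_via_low[OF not_I(2)] low(2) nbrs_eq(2) by blast
  obtain t where via_x: "conflicts_via v x \<subseteq> {t}"
    using conflicts_via_low[OF not_I(1)] low(1) nbrs_eq(1) by blast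
  have "a \<notin> S"
    by (rule not_in_S_if_two_conflicts[of a v s])
      (use nbrs_eq not_S via_y in \<open>auto simp: conflicts_via_def\<close>)
  then show "v \<notin> S"
    by (intro not_in_S_if_two_conflicts[of v y t])
      (use nbrs_eq not_S via_x in \<open>auto simp: conflicts_via_def\<close>)
qed

lemma solitary_triangle_conflicts:
  assumes nbrs_eq: "nbrs v = {a, b, x}" "nbrs a = {v, b}" "nbrs b = {v, a}" and a: "a \<in> I"
  shows "b \<notin> S" "v \<notin> I" "conflicts_via v a \<union> conflicts_via v b = {}"
proof -
  have a_not_S: "a \<notin> S" using I_not_in_S[OF a] .
  show "b \<notin> S"
    by (rule not_in_S_if_two_conflicts[of b v x])
      (use nbrs_eq a_not_S in \<open>auto simp: conflicts_via_def\<close>)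
  then show "conflicts_via v a \<union> conflicts_via v b = {}"
    using nbrs_eq a_not_S unfolding conflicts_via_def by auto
  show "v \<notin> I" using independentD[OF independent_I a] nbrs_eq(2) by blast
qed

lemma solitary_conflicts:
  assumes v: "solitary v"
  obtains a b x t where "nbrs v = {a, b, x}" "a \<notin> S" "b \<notin> S" "v \<notin> I"
    "conflicts_via v a \<union> conflicts_via v b \<subseteq> {t}"
proof -
  have cubic: "cubic v" using v unfolding solitary_def by blast
  show thesis
    using v
  proof (cases rule: solitary_cases)
    case (Triangle a b x)
    have swapped: "nbrs v = {b, a, x}" using Triangle(1) by auto
    from solitary_triangle_in_I[OF cubic Triangle] show thesis
    proof
      assume a: "a \<in> I"
      note conflicts = solitary_triangle_conflicts[OF Triangle a]
      show thesis
        using that[OF Triangle(1) I_not_in_S[OF a] conflicts(1,2)] conflicts(3) by simp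
    next
      assume b: "b \<in> I"
      note conflicts = solitary_triangle_conflicts[OF swapped Triangle(3,2) b]
      show thesis
        using that[OF swapped I_not_in_S[OF b] conflicts(1,2)] conflicts(3) by simp
    qed
  next
    case (Square a b x w)
    have in_I: "a \<in> I" "b \<in> I" using solitary_square_in_I[OF cubic Square(1-3)] by blast+
    then have not_S: "a \<notin> S" "b \<notin> S" using I_not_in_S by blast+
    have "v \<notin> I" using independentD[OF independent_I in_I(1)] Square(2) by blast
    moreover have "conflicts_via v a \<union> conflicts_via v b \<subseteq> {w}"
      using Square not_S unfolding conflicts_via_def by auto
    ultimately show thesis using that[OF Square(1) not_S] by simp
  qed
qed

lemma solitary_not_in_S:
  assumes v: "solitary v"
  shows "v \<notin> S"
proof
  assume v_in_S: "v \<in> S"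
  obtain a b x s where nbrs_eq: "nbrs v = {a, b, x}" and v_not_I: "v \<notin> I"
    and via_cycle: "conflicts_via v a \<union> conflicts_via v b \<subseteq> {s}" using solitary_conflicts[OF v] .
  have x: "x \<in> nbrs v" using nbrs_eq by blast
  obtain t where "conflicts_via v x \<subseteq> {t}"
  proof (cases "cubic x")
    case False
    then show thesis using conflicts_via_low[OF v_not_I x] that by blast
  next
    case True
    obtain a' b' x' where nbrs_eq_x: "nbrs x = {a', b', x'}" "a' \<notin> S" "b' \<notin> S"
      using solitary_conflicts[OF solitary_cubic_nbr[OF v x True]] by metis
    then have "x' = v" using nbrs_sym[OF x] v_in_S by auto
    then have "conflicts_via v x \<subseteq> {x}" using nbrs_eq_x unfolding conflicts_via_def by auto
    then show thesis by (rule that)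
  qed
  then have "(\<Union>n\<in>nbrs v. conflicts_via v n) \<subseteq> {s, t}" using nbrs_eq via_cycle by auto
  then show False using not_in_S_if_two_conflicts v_in_S by blast
qed

lemma cubic_in_S_twin_triangle:
  assumes "cubic u" "u \<in> S"
  obtains a b x y where "twin_triangle u a b x y" "x \<notin> I"
proof -
  have "\<not> solitary u" using solitary_not_in_S assms(2) by blast
  moreover have "\<not> twin_square u a b w x y" for a b w x y
    using twin_square_not_in_S assms(2) by blast
  ultimately obtain a b x y where "twin_triangle u a b x y"
    using assms(1) unfolding solitary_def by blast
  then show thesis using that twin_triangle_not_in_S_if_pendant_in_I assms(2) by blast
qed

lemma low_in_S_nbrs:
  assumes u: "u \<in> S" "\<not> cubic u"
  obtains z n where "nbrs u = {z, n}" "z \<in> I" "\<not> cubic z" "cubic n"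
proof -
  have u_verts: "u \<in> pverts G" "u \<notin> I" using u(1) S_subset by blast+
  then obtain z where z: "z \<in> nbrs u" "z \<in> I" "\<not> cubic z" using low_dominating u(2) by blast
  obtain t where via_z: "conflicts_via u z \<subseteq> {t}"
    using conflicts_via_low[OF u_verts(2) z(1,3)] .
  have "nbrs u \<noteq> {z}" using not_in_S_if_two_conflicts[of u t t] via_z u(1) by auto
  then obtain n where n: "n \<in> nbrs u" "n \<noteq> z" using z(1) by blast
  then have nbrs_eq: "nbrs u = {z, n}" using nbrs_eq_pair[OF u(2)] z(1) by blast
  have "cubic n"
  proof (rule ccontr)
    assume "\<not> cubic n"
    then obtain s where "conflicts_via u n \<subseteq> {s}"
      using conflicts_via_low[OF u_verts(2) n(1)] by blast
    then show False using not_in_S_if_two_conflicts[of u t s] via_z u(1) nbrs_eq by auto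
  qed
  then show thesis using that nbrs_eq z by blast
qed

lemma low_S_nbr_of_low_I_unique:
  assumes z: "z \<in> I" "\<not> cubic z"
    and p: "p \<in> nbrs z" "p \<in> S" "\<not> cubic p" and q: "q \<in> nbrs z" "q \<in> S" "\<not> cubic q"
  shows "p = q"
proof (rule ccontr)
  assume distinct: "p \<noteq> q"
  have only_z: "\<exists>n. nbrs u = {z, n} \<and> cubic n" if u: "u \<in> nbrs z" "u \<in> S" "\<not> cubic u" for u
    using low_in_S_nbrs[OF u(2,3)] nbrs_sym[OF u(1)] z(2) by (metis insertE singletonD)
  obtain m n where nbrs_eq: "nbrs p = {z, m}" "cubic m" "nbrs q = {z, n}" "cubic n"
    using only_z[OF p] only_z[OF q] by blast
  have "q \<notin> nbrs p" using nbrs_eq(1,2) q(2,3) I_not_in_S[OF z(1)] by auto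
  then obtain t where "t \<noteq> z" "\<not> cubic t" "t \<in> nbrs p \<union> nbrs q"
    using no_exchange[of z p q] z p q distinct S_subset by auto
  then show False using nbrs_eq by auto
qed

lemma no_cubic_S_nbr_beside_low:
  assumes z: "z \<in> I" "\<not> cubic z"
    and p: "p \<in> nbrs z" "p \<in> S" "\<not> cubic p" and q: "q \<in> nbrs z" "q \<in> S"
  shows "\<not> cubic q"
proof
  assume "cubic q"
  then obtain a b x y where triangle: "twin_triangle q a b x y" and x: "x \<notin> I"
    using cubic_in_S_twin_triangle q(2) by blast
  have "z \<in> nbrs q" using q(1) by (rule nbrs_sym)
  then have "z = b" using triangle z x unfolding twin_triangle_def by auto
  then show False using triangle p(1,3) unfolding twin_triangle_def by auto
qed

lemma low_not_in_S:
  assumes "\<not> cubic u"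
  shows "u \<notin> S"
proof
  assume u_in_S: "u \<in> S"
  then obtain z n where nbrs_eq: "nbrs u = {z, n}" and z: "z \<in> I" "\<not> cubic z" and n: "cubic n"
    using low_in_S_nbrs assms by blast
  have u: "u \<in> nbrs z" "u \<notin> I" using nbrs_eq nbrs_sym u_in_S S_subset by blast+
  have only_u: "q = u" if "q \<in> nbrs z" "q \<in> S" for q
    using low_S_nbr_of_low_I_unique[OF z] no_cubic_S_nbr_beside_low[OF z] u(1) u_in_S assms that
    by blast
  have "conflicts_via u z = {}" using only_u I_not_in_S[OF z(1)]
    unfolding conflicts_via_def by blast
  moreover obtain p q where "conflicts_via u n \<subseteq> {p, q}"
    using conflicts_via_cubic u(2) n nbrs_eq by blast
  ultimately show False using not_in_S_if_two_conflicts[of u p q] nbrs_eq u_in_S by auto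
qed

lemma S_empty: "S = {}"
proof (rule ccontr)
  assume "S \<noteq> {}"
  then obtain u where u: "u \<in> S" by blast
  then have "cubic u" using low_not_in_S by blast
  then obtain a b x y where triangle: "twin_triangle u a b x y"
    using cubic_in_S_twin_triangle[OF _ u] by metis
  then have nbrs_eq: "nbrs u = {a, b, x}" "nbrs a = {u, b, y}" "nbrs b = {u, a}"
    unfolding twin_triangle_def by simp_all
  have not_S: "b \<notin> S" "x \<notin> S" "y \<notin> S"
    using twin_triangle_not_cubic[OF triangle] low_not_in_S by blast+
  have "u \<notin> I" using u S_subset by blast
  then obtain t where via_x: "conflicts_via u x \<subseteq> {t}"
    using conflicts_via_low[of u x] twin_triangle_not_cubic[OF triangle] nbrs_eq(1) by blast
  have "u \<notin> S"
    by (rule not_in_S_if_two_conflicts[of u a t])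
      (use nbrs_eq not_S via_x in \<open>auto simp: conflicts_via_def\<close>)
  then show False using u by blast
qed

end

lemma (in low_first_independent_set) ex_few_conflicts:
  assumes "S \<subseteq> pverts G - I" "S \<noteq> {}"
  shows "\<exists>u\<in>S. card (nbrs2 u \<inter> S) < 3"
proof (rule ccontr)
  assume "\<not> ?thesis"
  then have "3 \<le> card (nbrs2 u \<inter> S)" if "u \<in> S" for u using that by force
  then interpret dense_conflicts G I S using assms(1) by unfold_locales
  show False using S_empty assms(2) by blast
qed

theorem theorem2:
  fixes G :: "'a pair_pre_digraph"
  assumes "pair_graph G"
    and "subcubic G"
    and "saturated 1 G"
    and "g3 G \<le> 4"
  shows "packing_colorable G [1, 2, 2, 2]"
proof -
  interpret pair_graph G by fact
  obtain I where "prioritized_independent_set G {v. degree G v \<noteq> 3} I"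
    using ex_prioritized_independent_set by blast
  then interpret prioritized_independent_set G "{v. degree G v \<noteq> 3}" I .
  interpret low_first_independent_set G I using assms by unfold_locales
  have "packing_colorable G (1 # replicate 3 2)"
    using independent_I ex_few_conflicts by (rule packing_colorable_if_degenerate)
  then show ?thesis by (simp add: eval_nat_numeral)
qed

end
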